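(* Let $1\leq r<n$. There is a bijection $\phi:\mathfrak{S}_{n-1}\times\{0,1,\dots,n-1\}\to\mathfrak{S}_n$ such that for all $\pi\in\mathfrak{S}_{n-1}$ and $0\leq c\leq n-1$, $$\mathrm{exc}_r(\phi(\pi,c))=\begin{cases}\mathrm{exc}_r(\pi) & \text{if } 0\leq c\leq \mathrm{exc}_r(\pi)+r-1,\\ \mathrm{exc}_r(\pi)+1 & \text{otherwise},\end{cases}$$ and $\mathrm{den}_r(\phi(\pi,c))=\mathrm{den}_r(\pi)+c$.
   Context: $\mathfrak{S}_m$ is the set of permutations of $[m]$, written $\pi=\pi_1\cdots\pi_m$. For a word $w$ of distinct integers, $\mathrm{inv}(w)$ is the number of pairs of positions $i<j$ with $w_i>w_j$. For $\pi\in\mathfrak{S}_m$: an index $i$ is an $r$-level excedance place of $\pi$ if $\pi_i>i$ and $\pi_i\geq r$. $\mathrm{Excp}_r(\pi)$ is the set of $r$-level excedance places and $\mathrm{Nexcp}_r(\pi)$ its complement in $[m]$; $\mathrm{Exc}_r(\pi)$ (resp. $\mathrm{Nexc}_r(\pi)$) is the word of values $\pi_i$ for $i$ in $\mathrm{Excp}_r(\pi)$ (resp. $\mathrm{Nexcp}_r(\pi)$) read in increasing order of $i$. $\mathrm{den}_r(\pi)=\sum_{i\in\mathrm{Excp}_r(\pi)} i+\mathrm{inv}(\mathrm{Exc}_r(\pi))+\mathrm{inv}(\mathrm{Nexc}_r(\pi))$ and $\mathrm{exc}_r(\pi)=|\{i: \pi_i>i\geq r\}|$. *)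

theory Defs
  imports Main "HOL-Combinatorics.Permutations"
begin

(* A permutation of [m] is a function p with p permutes {1..m}; its i-th letter is p i.
   Since such a p is the identity outside [m], the notions below carry m explicitly. *)

abbreviation Sym :: "nat \<Rightarrow> (nat \<Rightarrow> nat) set" where
  "Sym m \<equiv> {p. p permutes {1..m}}"

definition word_inv :: "nat list \<Rightarrow> nat" where
  "word_inv w = card {(i, j). i < j \<and> j < length w \<and> w ! i > w ! j}"

definition Excp :: "nat \<Rightarrow> nat \<Rightarrow> (nat \<Rightarrow> nat) \<Rightarrow> nat set" where
  "Excp r m p = {i \<in> {1..m}. p i > i \<and> p i \<ge> r}"

definition Nexcp :: "nat \<Rightarrow> nat \<Rightarrow> (nat \<Rightarrow> nat) \<Rightarrow> nat set" where
  "Nexcp r m p = {1..m} - Excp r m p"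

definition Exc :: "nat \<Rightarrow> nat \<Rightarrow> (nat \<Rightarrow> nat) \<Rightarrow> nat list" where
  "Exc r m p = map p (sorted_list_of_set (Excp r m p))"

definition Nexc :: "nat \<Rightarrow> nat \<Rightarrow> (nat \<Rightarrow> nat) \<Rightarrow> nat list" where
  "Nexc r m p = map p (sorted_list_of_set (Nexcp r m p))"

definition den :: "nat \<Rightarrow> nat \<Rightarrow> (nat \<Rightarrow> nat) \<Rightarrow> nat" where
  "den r m p = (\<Sum>i\<in>Excp r m p. i) + word_inv (Exc r m p) + word_inv (Nexc r m p)"

(* The level condition is on the place i here, but on the value p i in Excp, so in general
   exc r m p is not the cardinality of Excp r m p. *)
definition exc :: "nat \<Rightarrow> nat \<Rightarrow> (nat \<Rightarrow> nat) \<Rightarrow> nat" where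
  "exc r m p = card {i \<in> {1..m}. p i > i \<and> i \<ge> r}"

end

(*
  Idea: extend Han's insertion for Denert's statistic to level r.  Let E be the set of r-level
  excedance values of p in S_{n-1}, k its size, e = exc_r(p), and m = k - e the number of places
  below r with a value at least r.  Fix a threshold v >= r, let y be the least element of
  E + {n} that is >= v, and replace every element of E that is >= v by the next larger element of
  E + {n}; the value y is then free and is placed at a position x, while the other letters move to
  the remaining positions such that excedances and non-excedances each keep their relative order.

  (1) x = v and all places >= v move one step to the right.  If v is in E + {n}, then v becomes a
      fixed point and den_r grows by #{f in E. f >= v}, which gives c = 0, ..., k.  Otherwise v
      becomes an excedance place and den_r grows by v + #{f in E. f >= v}, which gives
      c = r + k, ..., n - 1.
  (2) v = r, the place r is inserted, and the small places are redistributed: a place i <= r that is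
      not a small excedance place becomes one, and y is put on the place x of the enlarged set
      Q of small excedance places.  Then den_r grows by e + i + #{q in Q. q < x}.  For i = r all x < r
      are allowed, giving c = e + r, ..., r + k - 1; for i < r the rank of x is chosen to be
      m - #{excedance places < i}, which makes the growth k + #{non-excedance places <= i} and so
      gives c = k + 1, ..., e + r - 1.

  The inserted permutation s determines p: in (1) v is the largest place q >= r with q <= s q and
  no r-level excedance value of s in [q, s q), and in (2) there is no such place.  So p and c (which
  is a difference of den_r) are determined by s, and the map is bijective because n! = (n-1)! n.
*)
theory Submission
  imports Defs "HOL-Library.Infinite_Set"
begin

subsection \<open>Order isomorphisms and inversions on finite sets of naturals\<close>

text \<open>Turns a numerical requirement into a choice: thresholds and places are later picked by
  their rank in a suitable set.\<close>

lemma ex_rank: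
  fixes A :: "nat set"
  assumes "finite A" "k < card A"
  shows "\<exists>a\<in>A. card {b \<in> A. b < a} = k"
proof -
  obtain h where h: "bij_betw h {..<card A} A" "strict_mono_on {..<card A} h"
    using ex_bij_betw_strict_mono_card[OF assms(1)] .
  have "{b \<in> A. b < h k} = h ` {..<k}"
  proof (intro set_eqI iffI)
    fix b assume "b \<in> {b \<in> A. b < h k}"
    then obtain l where "l < card A" "b = h l" "h l < h k"
      using h(1) by (auto simp: bij_betw_def)
    with assms(2) show "b \<in> h ` {..<k}"
      using strict_mono_on_less[OF h(2), of l k] by auto
  next
    fix b assume "b \<in> h ` {..<k}"
    with assms(2) show "b \<in> {b \<in> A. b < h k}"
      using h(1) strict_mono_onD[OF h(2)] by (auto simp: bij_betw_def)
  qed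
  moreover have "inj_on h {..<k}"
    using h(1) assms(2) by (auto simp: bij_betw_def inj_on_def)
  ultimately have "card {b \<in> A. b < h k} = k"
    by (simp add: card_image)
  moreover have "h k \<in> A"
    using h(1) assms(2) by (auto simp: bij_betw_def)
  ultimately show ?thesis by blast
qed

lemma rank_less:
  fixes A :: "nat set"
  assumes "finite A" "a \<in> A" "a < b"
  shows "card {c \<in> A. c < a} < card {c \<in> A. c < b}"
  using assms by (intro psubset_card_mono) auto

lemma rank_inj:
  fixes A :: "nat set"
  assumes "finite A" "a \<in> A" "b \<in> A" "card {c \<in> A. c < a} = card {c \<in> A. c < b}"
  shows "a = b"
  using rank_less[OF assms(1), of a b] rank_less[OF assms(1), of b a] assms by force

lemma ex_order_iso:
  fixes A B :: "nat set"
  assumes "finite A" "finite B" "card A = card B"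
  shows "\<exists>g. strict_mono_on A g \<and> g ` A = B"
proof -
  obtain h where h: "bij_betw h {..<card A} A" "strict_mono_on {..<card A} h"
    using ex_bij_betw_strict_mono_card[OF assms(1)] .
  obtain h' where h': "bij_betw h' {..<card A} B" "strict_mono_on {..<card A} h'"
    using ex_bij_betw_strict_mono_card[OF assms(2)] assms(3) by metis
  let ?k = "inv_into {..<card A} h"
  have k: "?k a < card A" "h (?k a) = a" if "a \<in> A" for a
    using that h(1) inv_into_into[of a h "{..<card A}"] f_inv_into_f[of a h "{..<card A}"]
    by (auto simp: bij_betw_def)
  have "strict_mono_on A (h' \<circ> ?k)"
  proof (rule strict_mono_onI)
    fix a b assume ab: "a \<in> A" "b \<in> A" "a < b"
    have "?k a < ?k b"
      using strict_mono_on_less[OF h(2), of "?k a" "?k b"] k ab by simp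
    thus "(h' \<circ> ?k) a < (h' \<circ> ?k) b"
      using strict_mono_onD[OF h'(2)] k ab by simp
  qed
  moreover have "(h' \<circ> ?k) ` A = B"
    using bij_betw_trans[OF bij_betw_inv_into[OF h(1)] h'(1)] by (simp add: bij_betw_def)
  ultimately show ?thesis by blast
qed

text \<open>A strictly monotone map preserves ranks, and an element of the image is determined by
  its rank. Hence the inserted permutation will determine how the places were moved.\<close>

lemma order_iso_unique:
  fixes A :: "nat set" and f g :: "nat \<Rightarrow> nat"
  assumes "finite A" "strict_mono_on A f" "strict_mono_on A g" "f ` A = g ` A" "a \<in> A"
  shows "f a = g a"
proof -
  have *: "card {c \<in> h ` A. c < h a} = card {c \<in> A. c < a}"
    if h: "strict_mono_on A h" for h :: "nat \<Rightarrow> nat"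
  proof -
    have "{c \<in> h ` A. c < h a} = h ` {c \<in> A. c < a}"
      using strict_mono_on_less[OF h] assms(5) by auto
    thus ?thesis
      using strict_mono_on_imp_inj_on[OF h] by (simp add: card_image inj_on_def)
  qed
  show ?thesis
    by (rule rank_inj[of "f ` A"]) (use assms *[of f] *[of g] in auto)
qed

text \<open>Inversions are indexed by places instead of word positions, so moving places or adding
  one needs no reindexing of lists.\<close>

definition set_inv :: "nat set \<Rightarrow> (nat \<Rightarrow> nat) \<Rightarrow> nat" where
  "set_inv A f = card {(i, j). i \<in> A \<and> j \<in> A \<and> i < j \<and> f j < f i}"

lemma word_inv_strict_sorted:
  assumes "sorted_wrt (<) xs"
  shows "word_inv (map f xs) = set_inv (set xs) f"
proof -
  have mono: "xs ! i < xs ! j \<longleftrightarrow> i < j" if "i < length xs" "j < length xs" for i j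
    using sorted_wrt_nth_less[OF assms, of i j] sorted_wrt_nth_less[OF assms, of j i] that
    by (cases i j rule: linorder_cases) auto
  let ?I = "{(i, j). i < j \<and> j < length xs \<and> f (xs ! j) < f (xs ! i)}"
  let ?J = "{(i, j). i \<in> set xs \<and> j \<in> set xs \<and> i < j \<and> f j < f i}"
  let ?h = "\<lambda>(i, j). (xs ! i, xs ! j)"
  have inj: "inj_on ?h ?I"
    using assms by (intro inj_onI) (auto simp: nth_eq_iff_index_eq strict_sorted_iff)
  have "?h ` ?I = ?J"
  proof
    show "?h ` ?I \<subseteq> ?J"
      using mono by auto
    show "?J \<subseteq> ?h ` ?I"
    proof clarify
      fix a b assume ab: "a \<in> set xs" "b \<in> set xs" "a < b" "f b < f a"
      then obtain i j where "a = xs ! i" "b = xs ! j" "i < length xs" "j < length xs"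
        by (metis in_set_conv_nth)
      with ab mono[of i j] show "(a, b) \<in> ?h ` ?I"
        by (intro image_eqI[of _ _ "(i, j)"]) auto
    qed
  qed
  with card_image[OF inj] have "card ?I = card ?J"
    by simp
  moreover have "{(i, j). i < j \<and> j < length (map f xs) \<and> map f xs ! i > map f xs ! j} = ?I"
    by auto
  ultimately show ?thesis
    by (simp only: word_inv_def set_inv_def)
qed

lemma word_inv_sorted_list_of_set:
  "finite A \<Longrightarrow> word_inv (map f (sorted_list_of_set A)) = set_inv A f"
  using word_inv_strict_sorted[OF strict_sorted_list_of_set, of f A] by simp

lemma set_inv_image:
  assumes "strict_mono_on A g"
    and "\<And>i j. i \<in> A \<Longrightarrow> j \<in> A \<Longrightarrow> f (g j) < f (g i) \<longleftrightarrow> h j < h i"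
  shows "set_inv (g ` A) f = set_inv A h"
proof -
  have "bij_betw (map_prod g g) {(i, j). i \<in> A \<and> j \<in> A \<and> i < j \<and> h j < h i}
    {(i, j). i \<in> g ` A \<and> j \<in> g ` A \<and> i < j \<and> f j < f i}"
    unfolding bij_betw_def
  proof
    show "inj_on (map_prod g g) {(i, j). i \<in> A \<and> j \<in> A \<and> i < j \<and> h j < h i}"
      by (rule inj_on_subset[OF map_prod_inj_on[OF strict_mono_on_imp_inj_on[OF assms(1)]
              strict_mono_on_imp_inj_on[OF assms(1)]]]) auto
  qed (use strict_mono_on_less[OF assms(1)] assms(2) in \<open>auto\<close>)
  thus ?thesis
    unfolding set_inv_def by (rule bij_betw_same_card[symmetric])
qed

lemma set_inv_insert:
  assumes "finite A" "x \<notin> A"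
  shows "set_inv (insert x A) f =
    set_inv A f + card {a \<in> A. a < x \<and> f x < f a} + card {a \<in> A. x < a \<and> f a < f x}"
proof -
  let ?I = "{(i, j). i \<in> A \<and> j \<in> A \<and> i < j \<and> f j < f i}"
  let ?L = "{a \<in> A. a < x \<and> f x < f a}" and ?R = "{a \<in> A. x < a \<and> f a < f x}"
  have fin: "finite ?I"
    by (rule finite_subset[of _ "A \<times> A"]) (use assms in auto)
  have "{(i, j). i \<in> insert x A \<and> j \<in> insert x A \<and> i < j \<and> f j < f i} =
      ?I \<union> (\<lambda>a. (a, x)) ` ?L \<union> (\<lambda>a. (x, a)) ` ?R"
    by auto
  moreover have "card (?I \<union> (\<lambda>a. (a, x)) ` ?L \<union> (\<lambda>a. (x, a)) ` ?R) =
      card ?I + card ((\<lambda>a. (a, x)) ` ?L) + card ((\<lambda>a. (x, a)) ` ?R)"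
    using assms fin by (subst card_Un_disjoint; (subst card_Un_disjoint)?) auto
  ultimately show ?thesis
    unfolding set_inv_def by (simp add: card_image inj_on_def)
qed

subsection \<open>Inserting a letter\<close>

text \<open>The value is meaningful only if \<open>F\<close> has an element at or above
  \<open>v\<close>; in the applications \<open>n\<close> is one.\<close>

definition succ_in :: "nat set \<Rightarrow> nat \<Rightarrow> nat" where
  "succ_in F v = (LEAST f. f \<in> F \<and> v \<le> f)"

lemma succ_in:
  assumes "f \<in> F" "v \<le> f"
  shows "succ_in F v \<in> F" "v \<le> succ_in F v" "succ_in F v \<le> f"
  using LeastI[of "\<lambda>f. f \<in> F \<and> v \<le> f" f] Least_le[of "\<lambda>f. f \<in> F \<and> v \<le> f" f] assms
  unfolding succ_in_def by auto

text \<open>Han's shift of the excedance values: for \<open>E\<close> below \<open>n\<close> and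
  \<open>v \<le> n\<close>, the value set free is \<open>succ_in (insert n E) v\<close>.\<close>

definition raise :: "nat set \<Rightarrow> nat \<Rightarrow> nat \<Rightarrow> nat \<Rightarrow> nat" where
  "raise E n v e = (if e \<in> E \<and> v \<le> e then succ_in (insert n E) (Suc e) else e)"

lemma raise_less:
  assumes "e \<in> E" "v \<le> e" "e < n"
  shows "e < raise E n v e" "raise E n v e \<in> insert n E"
    "f \<in> insert n E \<Longrightarrow> e < f \<Longrightarrow> raise E n v e \<le> f"
  using assms succ_in[of n "insert n E" "Suc e"] succ_in(3)[of f "insert n E" "Suc e"]
  unfolding raise_def by auto

lemma raise_ge: "e < n \<Longrightarrow> e \<le> raise E n v e"
  using raise_less(1)[of e E v n] by (cases "e \<in> E \<and> v \<le> e") (auto simp: raise_def)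

lemma raise_le: "e < n \<Longrightarrow> E \<subseteq> {..<n} \<Longrightarrow> raise E n v e \<le> n"
  using raise_less(2)[of e E v n] by (cases "e \<in> E \<and> v \<le> e") (auto simp: raise_def)

lemma raise_gt_succ_in:
  assumes "e \<in> E" "v \<le> e" "e < n"
  shows "succ_in (insert n E) v < raise E n v e"
  using succ_in(3)[of e "insert n E" v] raise_less(1)[OF assms] assms by auto

lemma raise_strict_mono:
  assumes "E \<subseteq> {..<n}"
  shows "strict_mono_on E (raise E n v)"
proof (rule strict_mono_onI)
  fix d e assume de: "d \<in> E" "e \<in> E" "d < e"
  hence *: "d < n" "e < n" using assms by auto
  show "raise E n v d < raise E n v e"
  proof (cases "v \<le> d")
    case True
    hence "raise E n v d \<le> e"
      using raise_less(3)[of d E v n e] de * by auto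
    also have "e < raise E n v e"
      using raise_less(1)[of e E v n] de * True by auto
    finally show ?thesis .
  next
    case False
    thus ?thesis
      using raise_ge[of e n E v] de * by (auto simp: raise_def)
  qed
qed

text \<open>A raised value lies above the freed one; an unchanged value is below \<open>v\<close> or
  outside \<open>insert n E\<close>.\<close>

lemma raise_neq_succ_in:
  assumes "E \<subseteq> {..<n}" "v \<le> n" "e < n"
  shows "raise E n v e \<noteq> succ_in (insert n E) v"
  using raise_gt_succ_in[of e E v n] succ_in(1,2)[of n "insert n E" v] assms
  by (cases "e \<in> E \<and> v \<le> e") (auto simp: raise_def)

text \<open>Values of \<open>E\<close> land in \<open>insert n E\<close> and all others stay outside
  it, so the two kinds cannot collide. On \<open>E\<close> the map is strictly monotone, elsewhere
  the identity.\<close>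

lemma raise_inj:
  assumes "E \<subseteq> {..<n}"
  shows "inj_on (raise E n v) {..<n}"
proof (rule inj_onI)
  fix d e assume de: "d \<in> {..<n}" "e \<in> {..<n}" "raise E n v d = raise E n v e"
  have *: "raise E n v e \<in> insert n E \<longleftrightarrow> e \<in> E" if "e < n" for e
    using raise_less(2)[of e E v n] that by (cases "e \<in> E \<and> v \<le> e") (auto simp: raise_def)
  hence "d \<in> E \<longleftrightarrow> e \<in> E"
    using de by (metis lessThan_iff)
  thus "d = e"
    using strict_mono_on_eq[OF raise_strict_mono[OF assms], of d e] de
    by (cases "d \<in> E") (auto simp: raise_def)
qed

text \<open>One inclusion suffices, since injectivity gives both sides the cardinality of
  \<open>E\<close>.\<close>

lemma raise_image:
  assumes "E \<subseteq> {..<n}" "v \<le> n"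
  shows "raise E n v ` E = insert n E - {succ_in (insert n E) v}"
proof (rule card_subset_eq)
  have fin: "finite E" using assms finite_subset by blast
  thus "finite (insert n E - {succ_in (insert n E) v})" by simp
  show "raise E n v ` E \<subseteq> insert n E - {succ_in (insert n E) v}"
  proof clarify
    fix e assume e: "e \<in> E"
    hence "e < n" using assms by auto
    thus "raise E n v e \<in> insert n E - {succ_in (insert n E) v}"
      using raise_neq_succ_in[OF assms, of e] raise_less(2)[of e E v n] e
      by (cases "v \<le> e") (auto simp: raise_def)
  qed
  have "n \<notin> E" using assms by auto
  moreover have "inj_on (raise E n v) E"
    using raise_strict_mono[OF assms(1)] strict_mono_on_imp_inj_on by blast
  ultimately show "card (raise E n v ` E) = card (insert n E - {succ_in (insert n E) v})"
    using fin succ_in(1)[of n "insert n E" v] assms(2) by (simp add: card_image)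
qed

lemma Excp_Un_Nexcp: "Excp r m p \<union> Nexcp r m p = {1..m}" "Excp r m p \<inter> Nexcp r m p = {}"
  by (auto simp: Excp_def Nexcp_def)

lemma finite_Excp [simp]: "finite (Excp r m p)" "finite (Nexcp r m p)"
  by (simp_all add: Excp_def Nexcp_def)

lemma den_eq: "den r m p = \<Sum>(Excp r m p) + set_inv (Excp r m p) p + set_inv (Nexcp r m p) p"
  unfolding den_def Exc_def Nexc_def by (simp add: word_inv_sorted_list_of_set)

text \<open>An excedance place at or above \<open>r\<close> automatically has its value above
  \<open>r\<close>.\<close>

lemma exc_eq: "exc r m p = card {q \<in> Excp r m p. r \<le> q}"
  unfolding exc_def Excp_def by (rule arg_cong[of _ _ card]) auto

text \<open>The letter at place \<open>q\<close> of \<open>p\<close> moves to place \<open>g q\<close> of \<open>s\<close>; the new place is \<open>x\<close>.\<close>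

locale insertion =
  fixes r n :: nat and p :: "nat \<Rightarrow> nat" and v x :: nat and g s :: "nat \<Rightarrow> nat"
  assumes r: "1 \<le> r" "r < n"
    and p: "p permutes {1..n - 1}" and s: "s permutes {1..n}"
    and v: "r \<le> v" "v \<le> n" and x: "1 \<le> x" "x \<le> v"
    and g: "bij_betw g {1..n - 1} ({1..n} - {x})"
    and mono_P: "strict_mono_on (Excp r (n - 1) p) g"
    and mono_N: "strict_mono_on (Nexcp r (n - 1) p) g"
    and g_ge: "\<And>q. v \<le> q \<Longrightarrow> q \<le> n - 1 \<Longrightarrow> g q = Suc q"
    and g_less: "\<And>q. 1 \<le> q \<Longrightarrow> q < v \<Longrightarrow> q \<le> n - 1 \<Longrightarrow> g q = q \<or> v = r \<and> g q \<le> r"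
    and s_x: "s x = succ_in (insert n (p ` Excp r (n - 1) p)) v"
    and s_g: "\<And>q. q \<in> {1..n - 1} \<Longrightarrow> s (g q) = raise (p ` Excp r (n - 1) p) n v (p q)"
begin

abbreviation "P \<equiv> Excp r (n - 1) p"
abbreviation "N \<equiv> Nexcp r (n - 1) p"
abbreviation "E \<equiv> p ` P"
abbreviation "F \<equiv> insert n E"
abbreviation "R \<equiv> raise E n v"

lemma P_D: "q \<in> P \<Longrightarrow> 1 \<le> q \<and> q \<le> n - 1 \<and> q < n \<and> q < p q \<and> r \<le> p q \<and> p q < n"
  using permutes_in_image[OF p, of q] r by (auto simp: Excp_def)

lemma N_D: "q \<in> N \<Longrightarrow> 1 \<le> q \<and> q \<le> n - 1 \<and> q < n \<and> (p q \<le> q \<or> p q < r) \<and> p q < n"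
  using permutes_in_image[OF p, of q] r by (auto simp: Excp_def Nexcp_def)

lemma p_mem_E: "q \<in> {1..n - 1} \<Longrightarrow> p q \<in> E \<longleftrightarrow> q \<in> P"
  using permutes_inj[OF p] by (auto simp: inj_def)

lemma E: "E \<subseteq> {..<n}" "e \<in> E \<Longrightarrow> r \<le> e"
  using P_D by auto

lemma N_notin: "q \<in> N \<Longrightarrow> q \<notin> P"
  by (auto simp: Nexcp_def)

lemma R_N: "q \<in> N \<Longrightarrow> R (p q) = p q"
  using p_mem_E[of q] N_D N_notin by (auto simp: raise_def)

lemma s_gN: "q \<in> N \<Longrightarrow> s (g q) = p q"
  using s_g[of q] R_N N_D by auto

lemma s_gP: "q \<in> P \<Longrightarrow> s (g q) = R (p q)"
  using s_g[of q] P_D by auto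

lemma s_x_least: "s x \<in> F" "v \<le> s x" "f \<in> F \<Longrightarrow> v \<le> f \<Longrightarrow> s x \<le> f"
  using succ_in[of n F v] succ_in(3)[of f F v] v s_x by auto

text \<open>Excedances survive the move. A place at or above \<open>v\<close> moves by one while its
  letter rises by at least one; a redistributed place, possible only for \<open>v = r\<close>, stays
  at most \<open>r\<close> while its letter is raised above \<open>r\<close>.\<close>

lemma g_lessP:
  assumes "q \<in> P"
  shows "g q < R (p q)"
proof (cases "v \<le> q")
  case True
  thus ?thesis
    using g_ge[of q] P_D[OF assms] raise_less(1)[of "p q" E v n] assms by auto
next
  case False
  hence "g q = q \<or> v = r \<and> g q \<le> r"
    using g_less[of q] P_D[OF assms] by auto
  moreover have "p q \<le> R (p q)" "r \<le> v \<Longrightarrow> v \<le> p q \<Longrightarrow> p q < R (p q)"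
    using raise_ge[of "p q" n E v] raise_less(1)[of "p q" E v n] P_D[OF assms] assms by auto
  ultimately show ?thesis
    using P_D[OF assms] by auto
qed

text \<open>Non-excedances survive as well: places stay or move right, except redistributed ones,
  whose letters are below \<open>r\<close>.\<close>

lemma g_geN:
  assumes "q \<in> N"
  shows "p q \<le> g q \<or> p q < r"
proof (cases "v \<le> q")
  case True
  thus ?thesis
    using g_ge[of q] N_D[OF assms] by auto
next
  case False
  hence "g q = q \<or> v = r \<and> g q \<le> r"
    using g_less[of q] N_D[OF assms] by auto
  thus ?thesis
    using N_D[OF assms] False by auto
qed

lemma g_neq_x: "q \<in> {1..n - 1} \<Longrightarrow> g q \<noteq> x \<and> 1 \<le> g q \<and> g q \<le> n"
  using g bij_betwE by fastforce

lemma ex_g: "q \<in> {1..n} \<Longrightarrow> q \<noteq> x \<Longrightarrow> (\<exists>q'\<in>P. q = g q') \<or> (\<exists>q'\<in>N. q = g q')"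
  using g Excp_Un_Nexcp(1)[of r "n - 1" p] unfolding bij_betw_def
  by (metis (no_types, lifting) DiffI UnE empty_iff image_iff insert_iff)

text \<open>Both kinds of old places keep their kind, so only \<open>x\<close> is open; its letter
  is at least \<open>v\<close>, so the level condition holds by itself.\<close>

lemma Excp_s: "Excp r n s = (if x < s x then insert x (g ` P) else g ` P)"
proof -
  have "q \<in> Excp r n s \<longleftrightarrow> q = x \<and> x < s x \<or> q \<in> g ` P" for q
  proof
    assume q: "q \<in> Excp r n s"
    hence "q \<in> {1..n}" "q < s q" "r \<le> s q" by (auto simp: Excp_def)
    thus "q = x \<and> x < s x \<or> q \<in> g ` P"
      using ex_g[of q] g_geN s_gN by fastforce
  next
    assume "q = x \<and> x < s x \<or> q \<in> g ` P"
    thus "q \<in> Excp r n s"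
    proof
      assume "q = x \<and> x < s x"
      thus ?thesis using s_x_least(2) v x by (auto simp: Excp_def)
    next
      assume "q \<in> g ` P"
      then obtain q' where q': "q' \<in> P" "q = g q'" by blast
      have "p q' \<le> R (p q')" using raise_ge P_D[OF q'(1)] by auto
      thus ?thesis
        using q' g_lessP[OF q'(1)] s_gP[OF q'(1)] P_D[OF q'(1)] g_neq_x[of q'] by (auto simp: Excp_def)
    qed
  qed
  thus ?thesis by auto
qed

lemma g_disjoint: "g ` P \<inter> g ` N = {}" "x \<notin> g ` P" "x \<notin> g ` N"
proof -
  have "inj_on g (P \<union> N)" using g by (simp add: Excp_Un_Nexcp bij_betw_def)
  thus "g ` P \<inter> g ` N = {}"
    using Excp_Un_Nexcp(2)[of r "n - 1" p] inj_on_image_Int[of g "P \<union> N" P N] by simp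
  have "g q \<noteq> x" if "q \<in> P \<or> q \<in> N" for q
    using that g_neq_x[of q] P_D[of q] N_D[of q] by auto
  thus "x \<notin> g ` P" "x \<notin> g ` N"
    by blast+
qed

lemma Nexcp_s: "Nexcp r n s = (if x < s x then g ` N else insert x (g ` N))"
proof -
  have "{1..n} = insert x (g ` (P \<union> N))"
    using g x v by (auto simp: Excp_Un_Nexcp bij_betw_def)
  thus ?thesis
    using g_disjoint unfolding Nexcp_def[of r n s] Excp_s by (auto simp: image_Un)
qed

lemma values_s: "s ` Excp r n s = (if x < s x then F else F - {s x})"
proof -
  have "s ` g ` P = R ` E"
    using s_gP by (force simp: image_iff)
  also have "\<dots> = F - {s x}"
    using raise_image[OF E(1) v(2)] s_x by simp
  finally show ?thesis
    using s_x_least(1) by (auto simp: Excp_s)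
qed

text \<open>Raising is strictly monotone on \<open>E\<close> and \<open>g\<close> is monotone on
  \<open>P\<close>, so no inversion among old excedance letters is gained or lost.\<close>

lemma set_inv_P: "set_inv (g ` P) s = set_inv P p"
  using strict_mono_on_less[OF raise_strict_mono[OF E(1), of v]]
  by (intro set_inv_image mono_P) (auto simp: s_gP)

lemma set_inv_N: "set_inv (g ` N) s = set_inv N p"
  by (intro set_inv_image mono_N) (auto simp: s_gN)

lemma card_image_g:
  assumes "strict_mono_on A g"
  shows "card {a \<in> g ` A. Q a} = card {q \<in> A. Q (g q)}"
proof -
  have "{a \<in> g ` A. Q a} = g ` {q \<in> A. Q (g q)}" by auto
  thus ?thesis
    using strict_mono_on_imp_inj_on[OF assms] by (simp add: card_image inj_on_def)
qed

text \<open>Here \<open>x\<close> joins the non-excedance word; the two cardinalities are the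
  inversions of its letter with earlier and later letters.\<close>

lemma den_fixed:
  assumes "\<not> x < s x"
  shows "den r n s = \<Sum>(g ` P) + set_inv P p + set_inv N p +
    card {q \<in> N. g q < x \<and> s x < p q} + card {q \<in> N. x < g q \<and> p q < s x}"
proof -
  have "card {a \<in> g ` N. a < x \<and> s x < s a} = card {q \<in> N. g q < x \<and> s x < p q}"
    "card {a \<in> g ` N. x < a \<and> s a < s x} = card {q \<in> N. x < g q \<and> p q < s x}"
    by (subst card_image_g[OF mono_N]; intro arg_cong[of _ _ card] Collect_cong; auto simp: s_gN)+
  thus ?thesis
    using assms set_inv_insert[of "g ` N" x s] g_disjoint set_inv_P set_inv_N
    by (simp add: den_eq[of r n s] Excp_s Nexcp_s)
qed

lemma den_excedance:
  assumes "x < s x"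
  shows "den r n s = x + \<Sum>(g ` P) + set_inv P p + set_inv N p +
    card {q \<in> P. g q < x \<and> s x < R (p q)} + card {q \<in> P. x < g q \<and> R (p q) < s x}"
proof -
  have "card {a \<in> g ` P. a < x \<and> s x < s a} = card {q \<in> P. g q < x \<and> s x < R (p q)}"
    "card {a \<in> g ` P. x < a \<and> s a < s x} = card {q \<in> P. x < g q \<and> R (p q) < s x}"
    by (subst card_image_g[OF mono_P]; intro arg_cong[of _ _ card] Collect_cong; auto simp: s_gP)+
  thus ?thesis
    using assms set_inv_insert[of "g ` P" x s] g_disjoint set_inv_P set_inv_N
    by (simp add: den_eq[of r n s] Excp_s Nexcp_s)
qed

end

section \<open>Crossings of a threshold and recovery of the inserted data\<close>

text \<open>Both sets complete the places below \<open>v\<close> with letter below \<open>v\<close>: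
  one to all places with letter below \<open>v\<close>, the other to all places below
  \<open>v\<close>. The permutation maps the first of these onto the second.\<close>

lemma permutes_crossing:
  fixes p :: "nat \<Rightarrow> nat" and v :: nat
  assumes "p permutes {1..m}"
  shows "card {q \<in> {1..m}. v \<le> q \<and> p q < v} = card {q \<in> {1..m}. q < v \<and> v \<le> p q}"
proof -
  let ?A = "{q \<in> {1..m}. q < v \<and> p q < v}"
  have "p ` {q \<in> {1..m}. p q < v} = p ` {1..m} \<inter> {..<v}"
    by auto
  also have "\<dots> = {q \<in> {1..m}. q < v}"
    using permutes_image[OF assms] by auto
  finally have "p ` {q \<in> {1..m}. p q < v} = {q \<in> {1..m}. q < v}" .
  hence "card {q \<in> {1..m}. p q < v} = card {q \<in> {1..m}. q < v}"
    using permutes_inj_on[OF assms] by (metis (no_types, lifting) card_image)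
  moreover have "?A \<union> {q \<in> {1..m}. v \<le> q \<and> p q < v} = {q \<in> {1..m}. p q < v}"
    "?A \<union> {q \<in> {1..m}. q < v \<and> v \<le> p q} = {q \<in> {1..m}. q < v}"
    by auto
  moreover have "card (?A \<union> {q \<in> {1..m}. v \<le> q \<and> p q < v}) = card ?A + card {q \<in> {1..m}. v \<le> q \<and> p q < v}"
    "card (?A \<union> {q \<in> {1..m}. q < v \<and> v \<le> p q}) = card ?A + card {q \<in> {1..m}. q < v \<and> v \<le> p q}"
    by (rule card_Un_disjoint; auto)+
  ultimately show ?thesis by simp
qed

text \<open>Serves to read the threshold off \<open>s\<close>: no r-level excedance value of
  \<open>s\<close> may lie in the interval from \<open>q\<close> to just below
  \<open>s q\<close>.\<close>

definition critical :: "nat \<Rightarrow> nat \<Rightarrow> (nat \<Rightarrow> nat) \<Rightarrow> nat \<Rightarrow> bool" where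
  "critical r n s q \<longleftrightarrow> r \<le> q \<and> q \<le> n \<and> q \<le> s q \<and> (\<forall>f \<in> s ` Excp r n s. q \<le> f \<longrightarrow> s q \<le> f)"

context insertion
begin

text \<open>A place beyond \<open>v\<close> comes from some \<open>q' \<ge> v\<close> with
  \<open>q = Suc q'\<close>. If \<open>q'\<close> was an excedance place, its old letter
  \<open>p q'\<close> is still an excedance value and lies in the forbidden interval; otherwise
  \<open>s q < q\<close>.\<close>

lemma critical_le:
  assumes "critical r n s q"
  shows "q \<le> v"
proof (rule ccontr)
  assume "\<not> q \<le> v"
  then obtain q' where q': "q = Suc q'" "v \<le> q'"
    by (cases q) auto
  with assms have "q' \<in> {1..n - 1}" "g q' = q"
    using g_ge[of q'] r v by (auto simp: critical_def)
  then consider "q' \<in> P" | "q' \<in> N"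
    using Excp_Un_Nexcp(1)[of r "n - 1" p] by blast
  thus False
  proof cases
    case 1
    have less: "p q' < R (p q')" "q \<le> p q'"
      using raise_less(1)[of "p q'" E v n] P_D[OF 1] q' 1 by auto
    have "s q = R (p q')"
      using s_gP[OF 1] \<open>g q' = q\<close> by simp
    moreover have "p q' \<in> s ` Excp r n s"
      using 1 q' x less(2) by (auto simp: values_s)
    ultimately show False
      using assms less by (fastforce simp: critical_def)
  next
    case 2
    thus False
      using assms s_gN[OF 2] N_D[OF 2] \<open>g q' = q\<close> q' v by (auto simp: critical_def)
  qed
qed

lemma sum_g:
  assumes "\<And>q. q \<in> P \<Longrightarrow> q < v \<Longrightarrow> g q = q"
  shows "\<Sum>(g ` P) = \<Sum>P + card {q \<in> P. v \<le> q}"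
proof -
  have "\<Sum>(g ` P) = (\<Sum>q\<in>P. g q)"
    using strict_mono_on_imp_inj_on[OF mono_P] by (simp add: sum.reindex)
  also have "\<dots> = (\<Sum>q\<in>P. q + (if v \<le> q then 1 else 0))"
    using assms g_ge P_D by (intro sum.cong) force+
  also have "\<dots> = \<Sum>P + card {q \<in> P. v \<le> q}"
    by (simp add: sum.distrib sum.If_cases Int_def)
  finally show ?thesis .
qed

end

text \<open>Deleting \<open>x\<close> from the excedance and non-excedance places of
  \<open>s\<close> leaves the images of the old ones, so uniqueness of order isomorphisms forces
  \<open>g\<close> and \<open>g'\<close> to agree on old places. Injectivity of raising then
  recovers the letters.\<close>

lemma insertion_inj:
  assumes "insertion r n p v x g s" "insertion r n p' v x g' s"
    and P: "Excp r (n - 1) p = Excp r (n - 1) p'"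
    and E: "p ` Excp r (n - 1) p = p' ` Excp r (n - 1) p'"
  shows "p = p'"
proof
  fix q
  interpret A: insertion r n p v x g s by fact
  interpret B: insertion r n p' v x g' s by fact
  have N: "A.N = B.N" by (simp only: Nexcp_def P)
  have "g ` A.P = Excp r n s - {x}" "g' ` B.P = Excp r n s - {x}"
    using A.Excp_s A.g_disjoint B.Excp_s B.g_disjoint by (auto split: if_splits)
  hence 1: "g q = g' q" if "q \<in> A.P"
    using order_iso_unique[OF _ A.mono_P, of g' q] B.mono_P that P by simp
  have "g ` A.N = Nexcp r n s - {x}" "g' ` B.N = Nexcp r n s - {x}"
    using A.Nexcp_s A.g_disjoint B.Nexcp_s B.g_disjoint by (auto split: if_splits)
  hence 2: "g q = g' q" if "q \<in> A.N"
    using order_iso_unique[OF _ A.mono_N, of g' q] B.mono_N that N by simp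
  show "p q = p' q"
  proof (cases "q \<in> {1..n - 1}")
    case True
    hence "g q = g' q"
      using 1 2 Excp_Un_Nexcp(1)[of r "n - 1" p] by blast
    hence "A.R (p q) = A.R (p' q)"
      using A.s_g[OF True] B.s_g[OF True] E by simp
    moreover have "p q < n" "p' q < n"
      using True permutes_in_image[OF A.p, of q] permutes_in_image[OF B.p, of q] by auto
    ultimately show ?thesis
      using raise_inj[OF A.E(1)] by (auto simp: inj_on_def)
  next
    case False
    thus ?thesis
      using A.p B.p by (metis permutes_not_in)
  qed
qed

section \<open>Insertion at the threshold itself\<close>

locale shift_insertion = insertion r n p v v g s for r n p v g s +
  assumes g_id: "1 \<le> q \<Longrightarrow> q < v \<Longrightarrow> q \<le> n - 1 \<Longrightarrow> g q = q"
begin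

lemma g_cmp: "1 \<le> q \<Longrightarrow> q \<le> n - 1 \<Longrightarrow> g q < v \<longleftrightarrow> q < v" "1 \<le> q \<Longrightarrow> q \<le> n - 1 \<Longrightarrow> v < g q \<longleftrightarrow> v \<le> q"
  using g_id[of q] g_ge[of q] by (cases "q < v"; auto)+

lemma exc_shift: "exc r n s = exc r (n - 1) p + (if v < s v then 1 else 0)"
proof -
  have "r \<le> g q \<longleftrightarrow> r \<le> q" if "q \<in> P" for q
    using P_D[OF that] g_id[of q] g_ge[of q] v by (cases "q < v") auto
  hence "{q \<in> P. r \<le> g q} = {q \<in> P. r \<le> q}" by auto
  hence *: "card {a \<in> g ` P. r \<le> a} = exc r (n - 1) p"
    using card_image_g[OF mono_P, of "\<lambda>q. r \<le> q"] by (simp add: exc_eq)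
  show ?thesis
  proof (cases "v < s v")
    case True
    hence "{q \<in> Excp r n s. r \<le> q} = insert v {a \<in> g ` P. r \<le> a}"
      using v by (auto simp: Excp_s)
    thus ?thesis
      using True * g_disjoint by (simp add: exc_eq[of r n s])
  next
    case False
    thus ?thesis
      using * by (simp add: exc_eq[of r n s] Excp_s)
  qed
qed

text \<open>The first summand will come from places moving right, the second from inversions with
  the new letter; together they give the growth of \<open>den\<close>.\<close>

lemma card_E_ge: "card {q \<in> P. v \<le> q} + card {q \<in> P. q < v \<and> v \<le> p q} = card {e \<in> E. v \<le> e}"
proof -
  have "{e \<in> E. v \<le> e} = p ` {q \<in> P. v \<le> p q}" by auto
  moreover have "inj_on p {q \<in> P. v \<le> p q}"
    using permutes_inj[OF p] by (auto simp: inj_def inj_on_def)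
  ultimately have "card {e \<in> E. v \<le> e} = card {q \<in> P. v \<le> p q}"
    by (simp add: card_image)
  also have "{q \<in> P. v \<le> p q} = {q \<in> P. v \<le> q} \<union> {q \<in> P. q < v \<and> v \<le> p q}"
    using P_D by force
  also have "card \<dots> = card {q \<in> P. v \<le> q} + card {q \<in> P. q < v \<and> v \<le> p q}"
    by (rule card_Un_disjoint) auto
  finally show ?thesis by simp
qed

lemma sum_g_shift: "\<Sum>(g ` P) = \<Sum>P + card {q \<in> P. v \<le> q}"
  using g_id P_D by (intro sum_g) auto

lemma den_shift_fixed:
  assumes "\<not> v < s v"
  shows "den r n s = den r (n - 1) p + card {e \<in> E. v \<le> e}"
proof -
  have [simp]: "s v = v" using assms s_x_least(2) by simp
  \<comment> \<open>A non-excedance place below \<open>v\<close> carries a letter below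
    \<open>v\<close>, since \<open>r \<le> v\<close>.\<close>
  have "card {q \<in> N. g q < v \<and> s v < p q} = 0"
    unfolding card_eq_0_iff using g_cmp(1) N_D v by fastforce
  moreover have "card {q \<in> N. v < g q \<and> p q < s v} = card {q \<in> {1..n - 1}. v \<le> q \<and> p q < v}"
    by (rule arg_cong[of _ _ card])
      (use g_cmp(2) N_D P_D Excp_Un_Nexcp(1)[of r "n - 1" p] in fastforce)
  \<comment> \<open>Crossing letters to the right of the threshold are traded for crossing
    excedances to its left.\<close>
  moreover have "card {q \<in> {1..n - 1}. q < v \<and> v \<le> p q} = card {q \<in> P. q < v \<and> v \<le> p q}"
    by (rule arg_cong[of _ _ card]) (use v in \<open>auto simp: Excp_def\<close>)
  ultimately show ?thesis
    using den_fixed[OF assms] card_E_ge sum_g_shift permutes_crossing[OF p, of v]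
      den_eq[of r "n - 1" p]
    by linarith
qed

text \<open>The new letter is smaller than exactly the raised letters. Hence it is inverted with the
  crossing excedances on its left and with nothing on its right, where every excedance letter is
  raised.\<close>

lemma den_shift_excedance:
  assumes "v < s v"
  shows "den r n s = den r (n - 1) p + v + card {e \<in> E. v \<le> e}"
proof -
  have gt: "s v < R (p q) \<longleftrightarrow> v \<le> p q" if "q \<in> P" for q
    using raise_gt_succ_in[of "p q" E v n] s_x s_x_least(2) P_D[OF that] that
    by (cases "v \<le> p q") (auto simp: raise_def)
  have "card {q \<in> P. v < g q \<and> R (p q) < s v} = 0"
    unfolding card_eq_0_iff using gt g_cmp(2) P_D by fastforce
  moreover have "card {q \<in> P. g q < v \<and> s v < R (p q)} = card {q \<in> P. q < v \<and> v \<le> p q}"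
    by (rule arg_cong[of _ _ card]) (use gt g_cmp(1) P_D in blast)
  ultimately show ?thesis
    using den_excedance[OF assms] card_E_ge sum_g_shift den_eq[of r "n - 1" p]
    by linarith
qed

text \<open>Together with \<open>critical_le\<close> this makes \<open>v\<close> the largest
  critical place of \<open>s\<close>.\<close>

lemma critical_shift: "critical r n s v"
  unfolding critical_def values_s using v s_x_least by auto

lemma P_eq: "P = {q \<in> {1..n - 1}. (if q < v then q else Suc q) \<in> Excp r n s - {v}}"
proof -
  have *: "q \<in> P \<longleftrightarrow> (if q < v then q else Suc q) \<in> Excp r n s - {v}" if q: "q \<in> {1..n - 1}" for q
  proof -
    have "q \<in> P \<longleftrightarrow> g q \<in> g ` P"
      using inj_on_image_mem_iff[of g "{1..n - 1}" q P] g q P_D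
      by (simp only: bij_betw_def subset_iff atLeastAtMost_iff) blast
    also have "g ` P = Excp r n s - {v}"
      using g_disjoint by (auto simp: Excp_s)
    also have "g q = (if q < v then q else Suc q)"
      using q g_id[of q] g_ge[of q] by auto
    finally show ?thesis .
  qed
  have "P \<subseteq> {1..n - 1}" using P_D by auto
  thus ?thesis
    using * by (simp only: set_eq_iff subset_iff mem_Collect_eq) blast
qed

text \<open>If \<open>v\<close> becomes a fixed point, it is the one element of \<open>F\<close>
  missing among the excedance values and must be put back before \<open>n\<close> is
  removed.\<close>

lemma E_eq: "E = s ` Excp r n s \<union> (if s v = v then {v} else {}) - {n}"
proof -
  have "n \<notin> E" using E(1) by auto
  moreover have "v \<in> F" if "s v = v" using s_x_least(1) that by simp
  moreover have "\<not> v < s v \<longleftrightarrow> s v = v" using s_x_least(2) by auto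
  ultimately show ?thesis
    unfolding values_s by (cases "v < s v") auto
qed

end

lemma shift_insertion_inj:
  assumes A: "shift_insertion r n p v g s" and B: "shift_insertion r n p' v' g' s"
  shows "p = p'"
proof -
  interpret A: shift_insertion r n p v g s by fact
  interpret B: shift_insertion r n p' v' g' s by fact
  have v: "v = v'"
    using A.critical_le[OF B.critical_shift] B.critical_le[OF A.critical_shift] by simp
  show ?thesis
  proof (rule insertion_inj)
    show "insertion r n p v v g s" by unfold_locales
    show "insertion r n p' v v g' s" unfolding v by unfold_locales
    show "A.P = B.P" unfolding A.P_eq B.P_eq v ..
    show "A.E = B.E" unfolding A.E_eq B.E_eq v ..
  qed
qed

section \<open>Insertion with redistribution of the places below the level\<close>

text \<open>Place \<open>i\<close> joins the small excedance places, while \<open>x\<close> receives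
  the freed letter. For \<open>i < r\<close>, \<open>rank\<close> ties the two together so that
  \<open>i\<close> can be read off \<open>s\<close>.\<close>

locale cross_insertion = insertion r n p r x g s for r n p x g s +
  fixes i :: nat
  assumes i: "i = r \<or> i \<in> Nexcp r (n - 1) p \<and> i < r"
    and x_mem: "x \<in> insert i {q \<in> Excp r (n - 1) p. q < r}"
    and x_less: "x < r"
    and g_small: "g ` {q \<in> Excp r (n - 1) p. q < r} = insert i {q \<in> Excp r (n - 1) p. q < r} - {x}"
    and rank: "i < r \<Longrightarrow> card {q \<in> insert i {q \<in> Excp r (n - 1) p. q < r}. q < x} +
      card {q \<in> Excp r (n - 1) p. q < i} = card {q \<in> Excp r (n - 1) p. q < r}"
begin

abbreviation "Q \<equiv> insert i {q \<in> P. q < r}"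
abbreviation "P\<^sub>r \<equiv> {q \<in> P. r \<le> q}"

lemma x_less_s: "x < s x"
  using x_less s_x_least(2) by simp

lemma i': "1 \<le> i" "i \<le> r" "i \<notin> {q \<in> P. q < r}"
  using i r N_D N_notin by auto

lemma P_split: "P = {q \<in> P. q < r} \<union> P\<^sub>r"
  by auto

lemma g_big: "g ` P\<^sub>r = Suc ` P\<^sub>r"
  using g_ge P_D by (intro image_cong) auto

lemma Excp_cross: "Excp r n s = Q \<union> Suc ` P\<^sub>r"
proof -
  have "g ` P = g ` {q \<in> P. q < r} \<union> g ` P\<^sub>r"
    by (subst P_split) (rule image_Un)
  thus ?thesis
    using x_less_s x_mem unfolding Excp_s g_small g_big by auto
qed

lemma Q_Int: "Q \<inter> Suc ` P\<^sub>r = {}"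
  using i' by auto

lemma exc_cross: "exc r n s = exc r (n - 1) p + (if i = r then 1 else 0)"
proof -
  have "{q \<in> Excp r n s. r \<le> q} = (if i = r then insert r (Suc ` P\<^sub>r) else Suc ` P\<^sub>r)"
    unfolding Excp_cross using i' by auto
  moreover have "r \<notin> Suc ` P\<^sub>r" by auto
  ultimately show ?thesis
    by (simp add: exc_eq card_image)
qed

text \<open>The place sum grows by \<open>i\<close> and by one for each excedance place at or above
  \<open>r\<close>. All of \<open>E\<close> is raised above the freed letter, so that letter is
  inverted exactly with the excedance places before \<open>x\<close>.\<close>

lemma den_cross: "den r n s = den r (n - 1) p + exc r (n - 1) p + i + card {q \<in> Q. q < x}"
proof -
  have "x + \<Sum>(g ` P) = \<Sum>(insert x (g ` P))"
    using g_disjoint by simp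
  also have "insert x (g ` P) = Q \<union> Suc ` P\<^sub>r"
    using x_less_s Excp_s Excp_cross by simp
  also have "\<Sum>(Q \<union> Suc ` P\<^sub>r) = \<Sum>Q + \<Sum>(Suc ` P\<^sub>r)"
    using Q_Int by (intro sum.union_disjoint) auto
  also have "\<Sum>Q = i + \<Sum>{q \<in> P. q < r}"
    using i' by simp
  also have "\<Sum>(Suc ` P\<^sub>r) = \<Sum>P\<^sub>r + exc r (n - 1) p"
    by (simp add: sum.reindex exc_eq sum_Suc)
  also have "i + \<Sum>{q \<in> P. q < r} + (\<Sum>P\<^sub>r + exc r (n - 1) p) = i + \<Sum>P + exc r (n - 1) p"
  proof -
    have "\<Sum>({q \<in> P. q < r} \<union> P\<^sub>r) = \<Sum>{q \<in> P. q < r} + \<Sum>P\<^sub>r"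
      by (rule sum.union_disjoint) auto
    thus ?thesis using P_split by simp
  qed
  finally have sum: "x + \<Sum>(g ` P) = i + \<Sum>P + exc r (n - 1) p" .
  have gt: "s x < R (p q)" if "q \<in> P" for q
    using raise_gt_succ_in[of "p q" E r n] s_x P_D[OF that] that by auto
  have "card {q \<in> P. x < g q \<and> R (p q) < s x} = 0"
    unfolding card_eq_0_iff using gt by fastforce
  moreover have "card {q \<in> P. g q < x \<and> s x < R (p q)} = card {q \<in> P. g q < x}"
    by (rule arg_cong[of _ _ card]) (use gt in blast)
  moreover have "card {q \<in> P. g q < x} = card {a \<in> g ` P. a < x}"
    by (rule card_image_g[OF mono_P, symmetric])
  moreover have "card {a \<in> g ` P. a < x} = card {q \<in> Q. q < x}"
  proof (rule arg_cong[of _ _ card])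
    have "{a \<in> g ` P. a < x} = {a \<in> insert x (g ` P). a < x}"
      by auto
    also have "insert x (g ` P) = Q \<union> Suc ` P\<^sub>r"
      using x_less_s Excp_s Excp_cross by simp
    also have "{a \<in> Q \<union> Suc ` P\<^sub>r. a < x} = {q \<in> Q. q < x}"
      using x_less by auto
    finally show "{a \<in> g ` P. a < x} = {q \<in> Q. q < x}" .
  qed
  ultimately show ?thesis
    using den_excedance[OF x_less_s] sum den_eq[of r "n - 1" p] by linarith
qed

text \<open>Only \<open>q = r\<close> could be critical. If \<open>r\<close> comes from an excedance
  place, the freed letter is an excedance value in the forbidden interval; otherwise
  \<open>r\<close> comes from a smaller place, whose letter is below \<open>r\<close>.\<close>

lemma not_critical: "\<not> critical r n s q"
proof
  assume crit: "critical r n s q"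
  hence "q = r" using critical_le[OF crit] by (auto simp: critical_def)
  with crit have *: "r \<le> s r" "f \<in> s ` Excp r n s \<Longrightarrow> r \<le> f \<Longrightarrow> s r \<le> f" for f
    by (auto simp: critical_def)
  have "r \<in> {1..n}" "r \<noteq> x" using r x_less by auto
  then consider q' where "q' \<in> P" "r = g q'" | q' where "q' \<in> N" "r = g q'"
    using ex_g by blast
  thus False
  proof cases
    case 1
    have "s x < s r"
      using raise_gt_succ_in[of "p q'" E r n] s_x s_gP[OF 1(1)] P_D[OF 1(1)] 1 by auto
    moreover have "s x \<in> s ` Excp r n s"
      using x_less_s s_x_least(1) by (simp add: values_s)
    ultimately show False
      using *(2)[of "s x"] s_x_least(2) by auto
  next
    case 2
    hence "s r = p q'" using s_gN by simp
    moreover have "q' < r"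
      using g_ge[of q'] 2 N_D[OF 2(1)] by (cases "r \<le> q'") auto
    ultimately show False
      using N_D[OF 2(1)] *(1) by auto
  qed
qed

lemma E_cross: "E = s ` Excp r n s - {n}"
  using E(1) x_less_s by (auto simp: values_s)

lemma Q_eq: "Q = {q \<in> Excp r n s. q \<le> r}"
  unfolding Excp_cross using i' by auto

lemma P_cross: "P = ({q \<in> Excp r n s. q \<le> r} - {i}) \<union> {q. r \<le> q \<and> Suc q \<in> Excp r n s}"
proof -
  have "{q. r \<le> q \<and> Suc q \<in> Excp r n s} = P\<^sub>r"
    unfolding Excp_cross using i' by auto
  moreover have "{q \<in> P. q < r} = {q \<in> Excp r n s. q \<le> r} - {i}"
    using i' unfolding Q_eq[symmetric] by auto
  ultimately show ?thesis
    using P_split by blast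
qed

lemma i_eq: "i = r \<longleftrightarrow> r \<in> Excp r n s"
  unfolding Excp_cross by auto

text \<open>Rewrites \<open>rank\<close> through \<open>Q\<close> and \<open>x\<close> alone, both
  of which are visible in \<open>s\<close>.\<close>

lemma i_rank:
  assumes "i \<noteq> r"
  shows "card {q \<in> Q. q < i} = card Q - 1 - card {q \<in> Q. q < x}"
proof -
  have "{q \<in> Q. q < i} = {q \<in> P. q < i}"
    using i' by auto
  thus ?thesis
    using rank i' assms by simp
qed

end

text \<open>The freed letter is the least excedance value of \<open>s\<close> that is at least
  \<open>r\<close>, which yields \<open>x\<close>. Whether \<open>r\<close> is an excedance place
  decides \<open>i = r\<close>; otherwise the rank of \<open>i\<close> in \<open>Q\<close>
  determines it.\<close>

lemma cross_insertion_inj: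
  assumes "cross_insertion r n p x g s i" "cross_insertion r n p' x' g' s i'"
  shows "p = p'"
proof -
  interpret A: cross_insertion r n p x g s i by fact
  interpret B: cross_insertion r n p' x' g' s i' by fact
  have F: "A.F = B.F"
    using A.values_s A.x_less_s B.values_s B.x_less_s by simp
  have "s x = s x'"
    using A.s_x_least(1,2) A.s_x_least(3)[of "s x'"] B.s_x_least(1,2) B.s_x_least(3)[of "s x"] F
    by (intro antisym) auto
  hence x: "x = x'"
    using permutes_inj[OF A.s] by (simp add: inj_eq)
  have Q: "A.Q = B.Q"
    unfolding A.Q_eq B.Q_eq ..
  have i: "i = i'"
  proof (cases "r \<in> Excp r n s")
    case True
    thus ?thesis using A.i_eq B.i_eq by simp
  next
    case False
    hence "i \<noteq> r" "i' \<noteq> r" using A.i_eq B.i_eq by auto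
    from A.i_rank[OF this(1)] B.i_rank[OF this(2)]
    have card: "card {q \<in> A.Q. q < i} = card {q \<in> A.Q. q < i'}"
      by (simp only: Q x)
    have "i' \<in> A.Q" using Q by simp
    thus ?thesis
      by (intro rank_inj[OF _ _ _ card]) auto
  qed
  show ?thesis
  proof (rule insertion_inj)
    show "insertion r n p r x g s" by unfold_locales
    show "insertion r n p' r x g' s" unfolding x by unfold_locales
    show "A.P = B.P" unfolding A.P_cross B.P_cross i ..
    show "A.E = B.E" unfolding A.E_cross B.E_cross ..
  qed
qed

section \<open>Both insertions as one injective relation\<close>

definition inserts :: "nat \<Rightarrow> nat \<Rightarrow> (nat \<Rightarrow> nat) \<Rightarrow> (nat \<Rightarrow> nat) \<Rightarrow> bool" where
  "inserts r n p s \<longleftrightarrow>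
    (\<exists>v g. shift_insertion r n p v g s) \<or> (\<exists>x g i. cross_insertion r n p x g s i)"

text \<open>A critical place exists after the first kind of insertion and never after the second, so
  the kinds cannot mix.\<close>

lemma inserts_inj:
  assumes "inserts r n p s" "inserts r n p' s"
  shows "p = p'"
proof -
  have "\<not> (shift_insertion r n q v g s \<and> cross_insertion r n q' x h s i)" for q q' v g x h i
    using cross_insertion.not_critical shift_insertion.critical_shift by blast
  thus ?thesis
    using assms shift_insertion_inj[of r n p _ _ s p'] cross_insertion_inj[of r n p _ _ s _ p']
    unfolding inserts_def by blast
qed

lemma inserts_permutes: "inserts r n p s \<Longrightarrow> s permutes {1..n}"
  unfolding inserts_def shift_insertion_def cross_insertion_def insertion_def by blast

subsection \<open>Existence of the insertions\<close>

text \<open>The values of \<open>s\<close> on \<open>{1..n}\<close> are forced; injectivity holds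
  because raising is injective and avoids the freed value, and finiteness gives
  surjectivity.\<close>

lemma ex_inserted_perm:
  assumes n: "1 \<le> n" and p: "p permutes {1..n - 1}" and v: "v \<le> n" and x: "x \<in> {1..n}"
    and E: "E \<subseteq> {1..n - 1}" and g: "bij_betw g {1..n - 1} ({1..n} - {x})"
    and y: "1 \<le> succ_in (insert n E) v"
  shows "\<exists>s. s permutes {1..n} \<and> s x = succ_in (insert n E) v \<and>
    (\<forall>q\<in>{1..n - 1}. s (g q) = raise E n v (p q))"
proof -
  let ?y = "succ_in (insert n E) v"
  define h where "h = inv_into {1..n - 1} g"
  define s where "s q = (if q = x then ?y else if q \<in> {1..n} then raise E n v (p (h q)) else q)" for q
  have E': "E \<subseteq> {..<n}" using E n by fastforce
  have p_less: "1 \<le> p q" "p q < n" if "q \<in> {1..n - 1}" for q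
    using permutes_in_image[OF p, of q] that by auto
  have sg: "s (g q) = raise E n v (p q)" if "q \<in> {1..n - 1}" for q
    using that g bij_betwE[OF g] bij_betw_inv_into_left[OF g] by (auto simp: s_def h_def)
  have "inj_on (s \<circ> g) {1..n - 1}"
  proof (rule inj_onI)
    fix a b assume ab: "a \<in> {1..n - 1}" "b \<in> {1..n - 1}" "(s \<circ> g) a = (s \<circ> g) b"
    hence "raise E n v (p a) = raise E n v (p b)" using sg by simp
    hence "p a = p b"
      using inj_onD[OF raise_inj[OF E']] p_less ab by auto
    thus "a = b" using permutes_inj[OF p] by (simp add: inj_eq)
  qed
  hence "inj_on s (g ` {1..n - 1})"
    by (rule inj_on_imageI)
  moreover have "s x \<notin> s ` g ` {1..n - 1}"
  proof -
    have "s x \<noteq> s (g q)" if "q \<in> {1..n - 1}" for q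
      using sg[OF that] raise_neq_succ_in[OF E' v, of "p q"] p_less[OF that] by (simp add: s_def)
    thus ?thesis by blast
  qed
  moreover have range: "{1..n} = insert x (g ` {1..n - 1})"
    using g x by (auto simp: bij_betw_def)
  ultimately have inj: "inj_on s {1..n}"
    unfolding range inj_on_insert by blast
  have "?y \<le> n"
    using succ_in(3)[of n "insert n E" v] v by simp
  hence "s x \<in> {1..n}" using y by (simp add: s_def)
  moreover have "s (g q) \<in> {1..n}" if "q \<in> {1..n - 1}" for q
    using sg[OF that] p_less[OF that] raise_ge[of "p q" n E v] raise_le[of "p q" n E v] E' by simp
  ultimately have "s ` insert x (g ` {1..n - 1}) \<subseteq> {1..n}"
    by blast
  hence "s ` {1..n} \<subseteq> {1..n}"
    unfolding range[symmetric] .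
  hence "s ` {1..n} = {1..n}"
    by (intro endo_inj_surj inj) auto
  hence "s permutes {1..n}"
    using inj x by (intro bij_imp_permutes) (auto simp: bij_betw_def s_def)
  thus ?thesis
    using sg by (intro exI[of _ s]) (auto simp: s_def)
qed

lemma Excp_image:
  assumes "p permutes {1..m}"
  shows "p ` Excp r m p \<subseteq> {r..m}"
proof
  fix e assume "e \<in> p ` Excp r m p"
  then obtain q where q: "q \<in> {1..m}" "e = p q" "r \<le> e"
    by (auto simp: Excp_def)
  thus "e \<in> {r..m}"
    using permutes_in_image[OF assms, of q] by simp
qed

lemma ex_insertion:
  assumes r: "1 \<le> r" "r < n" and p: "p permutes {1..n - 1}"
    and v: "r \<le> v" "v \<le> n" and x: "1 \<le> x" "x \<le> v"
    and g: "bij_betw g {1..n - 1} ({1..n} - {x})"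
    and mono: "strict_mono_on (Excp r (n - 1) p) g" "strict_mono_on (Nexcp r (n - 1) p) g"
    and g_ge: "\<And>q. v \<le> q \<Longrightarrow> q \<le> n - 1 \<Longrightarrow> g q = Suc q"
    and g_less: "\<And>q. 1 \<le> q \<Longrightarrow> q < v \<Longrightarrow> q \<le> n - 1 \<Longrightarrow> g q = q \<or> v = r \<and> g q \<le> r"
  shows "\<exists>s. insertion r n p v x g s"
proof -
  let ?E = "p ` Excp r (n - 1) p"
  have "?E \<subseteq> {1..n - 1}"
    using r(1) by (intro subset_trans[OF Excp_image[OF p]]) simp
  moreover have "1 \<le> succ_in (insert n ?E) v"
    using succ_in(2)[of n "insert n ?E" v] r v by simp
  ultimately obtain s where "s permutes {1..n}" "s x = succ_in (insert n ?E) v"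
    "\<forall>q\<in>{1..n - 1}. s (g q) = raise ?E n v (p q)"
    using ex_inserted_perm[of n p v x ?E g] r p v x g by auto
  hence "insertion r n p v x g s"
    by (intro insertion.intro) (use assms in auto)
  thus ?thesis by blast
qed

lemma ex_shift_insertion:
  assumes r: "1 \<le> r" "r < n" and p: "p permutes {1..n - 1}" and v: "r \<le> v" "v \<le> n"
  shows "\<exists>g s. shift_insertion r n p v g s"
proof -
  define g where "g q = (if q < v then q else Suc q)" for q
  have mono: "strict_mono_on A g" for A
    by (rule strict_mono_onI) (auto simp: g_def)
  have "g ` {1..n - 1} = {1..n} - {v}"
  proof
    show "g ` {1..n - 1} \<subseteq> {1..n} - {v}"
      using r v by (auto simp: g_def)
    show "{1..n} - {v} \<subseteq> g ` {1..n - 1}"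
    proof
      fix q assume "q \<in> {1..n} - {v}"
      hence "q = g (if q < v then q else q - 1)" "(if q < v then q else q - 1) \<in> {1..n - 1}"
        using r v by (auto simp: g_def)
      thus "q \<in> g ` {1..n - 1}" by blast
    qed
  qed
  hence "bij_betw g {1..n - 1} ({1..n} - {v})"
    using strict_mono_on_imp_inj_on[OF mono] by (simp add: bij_betw_def)
  then obtain s where "insertion r n p v v g s"
    using ex_insertion[OF r p v, of v g] mono r v by (force simp: g_def)
  hence "shift_insertion r n p v g s"
    by (intro shift_insertion.intro shift_insertion_axioms.intro) (simp_all add: g_def)
  thus ?thesis by blast
qed

lemma ex_cross_insertion:
  assumes r: "1 \<le> r" "r < n" and p: "p permutes {1..n - 1}"
    and i: "i = r \<or> i \<in> Nexcp r (n - 1) p \<and> i < r"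
    and x: "x \<in> insert i {q \<in> Excp r (n - 1) p. q < r}" "x < r"
    and rank: "i < r \<Longrightarrow> card {q \<in> insert i {q \<in> Excp r (n - 1) p. q < r}. q < x} +
      card {q \<in> Excp r (n - 1) p. q < i} = card {q \<in> Excp r (n - 1) p. q < r}"
  shows "\<exists>g s. cross_insertion r n p x g s i"
proof -
  define A where "A = {q \<in> Excp r (n - 1) p. q < r}"
  define B where "B = {q \<in> Nexcp r (n - 1) p. q < r}"
  let ?Q = "insert i A"
  have [simp]: "finite A" "finite B" by (simp_all add: A_def B_def)
  have AB: "A \<union> B = {1..<r}" "A \<inter> B = {}"
    using Excp_Un_Nexcp[of r "n - 1" p] r(2) by (auto simp: A_def B_def)
  have iB: "i = r \<or> i \<in> B" using i by (simp add: B_def)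
  have xQ: "x \<in> ?Q" using x(1) by (simp add: A_def)
  have A: "A \<subseteq> {1..<r}" and B: "B \<subseteq> {1..<r}" using AB(1) by blast+
  have i': "i \<notin> A" using iB AB(2) A by auto
  have Q: "?Q \<subseteq> {1..r}" using A B iB r(1) by auto
  hence x': "1 \<le> x" using xQ by auto
  have "card A = card (?Q - {x})"
    using i' xQ by simp
  then obtain g1 where g1: "strict_mono_on A g1" "g1 ` A = ?Q - {x}"
    using ex_order_iso[of A "?Q - {x}"] by auto
  have "card A + card B = r - 1"
    using card_Un_disjoint[of A B] AB by simp
  moreover have "card ({1..r} - ?Q) = r - card ?Q"
    using Q by (simp add: card_Diff_subset)
  ultimately have "card B = card ({1..r} - ?Q)"
    using i' by simp
  then obtain g2 where g2: "strict_mono_on B g2" "g2 ` B = {1..r} - ?Q"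
    using ex_order_iso[of B "{1..r} - ?Q"] by auto
  \<comment> \<open>Small excedance places fill \<open>?Q\<close> without \<open>x\<close>, small
    non-excedance places fill the rest of \<open>{1..r}\<close>, and all other places move
    right.\<close>
  define g where "g q = (if r \<le> q then Suc q else if q \<in> A then g1 q else g2 q)" for q
  have eqA: "g q = g1 q" if "q \<in> A" for q
    using that A by (auto simp: g_def)
  have eqB: "g q = g2 q" if "q \<in> B" for q
    using that B AB(2) by (auto simp: g_def)
  have gP: "g ` A = ?Q - {x}"
    using g1(2) eqA by (simp cong: image_cong)
  have gN: "g ` B = {1..r} - ?Q"
    using g2(2) eqB by (simp cong: image_cong)
  have le: "g q \<le> r" if "1 \<le> q" "q < r" for q
  proof -
    have "q \<in> A \<union> B" using AB(1) that by auto
    hence "g q \<in> g ` A \<union> g ` B" by blast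
    also have "\<dots> \<subseteq> {1..r}" unfolding gP gN using Q by blast
    finally show ?thesis by simp
  qed
  \<comment> \<open>Monotonicity only needs checking below \<open>r\<close>: smaller places are sent
    to at most \<open>r\<close>, the others beyond it.\<close>
  have mono: "strict_mono_on C g"
    if C: "C \<subseteq> {1..}" "strict_mono_on {q \<in> C. q < r} g" for C
  proof (rule strict_mono_onI)
    fix a b assume ab: "a \<in> C" "b \<in> C" "a < b"
    show "g a < g b"
    proof (cases "b < r")
      case True
      thus ?thesis using strict_mono_onD[OF C(2), of a b] ab by auto
    next
      case False
      thus ?thesis using le[of a] ab C(1) by (cases "a < r") (auto simp: g_def)
    qed
  qed
  have mono_P: "strict_mono_on (Excp r (n - 1) p) g"
  proof (rule mono)
    show "strict_mono_on {q \<in> Excp r (n - 1) p. q < r} g"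
      unfolding A_def[symmetric] using strict_mono_onD[OF g1(1)] eqA by (intro strict_mono_onI) simp
  qed (auto simp: Excp_def)
  have mono_N: "strict_mono_on (Nexcp r (n - 1) p) g"
  proof (rule mono)
    show "strict_mono_on {q \<in> Nexcp r (n - 1) p. q < r} g"
      unfolding B_def[symmetric] using strict_mono_onD[OF g2(1)] eqB by (intro strict_mono_onI) simp
  qed (auto simp: Nexcp_def)
  have big: "g ` {r..n - 1} = {Suc r..n}"
  proof -
    have "g ` {r..n - 1} = Suc ` {r..n - 1}"
      by (rule image_cong) (auto simp: g_def)
    thus ?thesis using r by simp
  qed
  have "{1..n - 1} = A \<union> B \<union> {r..n - 1}"
    unfolding AB(1) using r by auto
  hence "g ` {1..n - 1} = (?Q - {x}) \<union> ({1..r} - ?Q) \<union> {Suc r..n}"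
    by (simp only: image_Un gP gN big)
  also have "\<dots> = {1..n} - {x}"
    using Q xQ r(2) by auto
  finally have img: "g ` {1..n - 1} = {1..n} - {x}" .
  moreover have "inj_on g {1..n - 1}"
  proof (rule eq_card_imp_inj_on)
    have "card ({1..n} - {x}) = n - 1" using x' x(2) r by simp
    thus "card (g ` {1..n - 1}) = card {1..n - 1}" unfolding img by simp
  qed simp
  ultimately have "bij_betw g {1..n - 1} ({1..n} - {x})"
    by (simp add: bij_betw_def)
  then obtain s where "insertion r n p r x g s"
    using ex_insertion[OF r p order_refl _ _ _ _ mono_P mono_N, of x] x' x r le
    by (force simp: g_def)
  hence "cross_insertion r n p x g s i"
    by (intro cross_insertion.intro cross_insertion_axioms.intro) (use i x gP rank in \<open>simp_all add: A_def\<close>)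
  thus ?thesis by blast
qed

section \<open>Realizing every increment\<close>

lemma ex_inserts:
  assumes r: "1 \<le> r" "r < n" and p: "p permutes {1..n - 1}" and c: "c \<le> n - 1"
  shows "\<exists>s. inserts r n p s \<and>
    exc r n s = (if c \<le> exc r (n - 1) p + r - 1 then exc r (n - 1) p else exc r (n - 1) p + 1) \<and>
    den r n s = den r (n - 1) p + c"
proof -
  define P where "P = Excp r (n - 1) p"
  define E where "E = p ` P"
  define A where "A = {q \<in> P. q < r}"
  define B where "B = {q \<in> Nexcp r (n - 1) p. q < r}"
  define e where "e = exc r (n - 1) p"
  have fin: "finite P" "finite E" "finite A" "finite B"
    by (simp_all add: P_def E_def A_def B_def)
  have "E \<subseteq> {r..n - 1}"
    using Excp_image[OF p] by (simp add: E_def P_def)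
  also have "\<dots> \<subseteq> {r..<n}"
    using r by auto
  finally have E: "E \<subseteq> {r..<n}" .
  have AB: "A \<union> B = {1..<r}" "A \<inter> B = {}"
    using Excp_Un_Nexcp[of r "n - 1" p] r(2) by (auto simp: A_def B_def P_def)
  have card_AB: "card A + card B = r - 1"
    using card_Un_disjoint[of A B] AB fin by simp
  have "card P = card A + e"
  proof -
    have "card (A \<union> {q \<in> P. r \<le> q}) = card A + card {q \<in> P. r \<le> q}"
      by (rule card_Un_disjoint) (use fin in \<open>auto simp: A_def\<close>)
    moreover have "A \<union> {q \<in> P. r \<le> q} = P" by (auto simp: A_def)
    ultimately show ?thesis by (simp add: e_def exc_eq P_def)
  qed
  moreover have "card E = card P"
    unfolding E_def using permutes_inj_on[OF p] by (rule card_image)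
  ultimately have card_E: "card E = card A + e" by simp
  have split_E: "card {f \<in> E. f < v} + card {f \<in> E. v \<le> f} = card E" for v
  proof -
    have "card ({f \<in> E. f < v} \<union> {f \<in> E. v \<le> f}) = card {f \<in> E. f < v} + card {f \<in> E. v \<le> f}"
      by (rule card_Un_disjoint) (use fin in auto)
    moreover have "{f \<in> E. f < v} \<union> {f \<in> E. v \<le> f} = E" by auto
    ultimately show ?thesis by simp
  qed
  \<comment> \<open>As \<open>card E = card A + e\<close> and \<open>card A \<le> r - 1\<close>, the
    first two ranges are those where \<open>exc\<close> must stay unchanged.\<close>
  consider "c \<le> card E" | "card E < c" "c < e + r" | "e + r \<le> c" "c < r + card E" | "r + card E \<le> c"
    by linarith
  thus ?thesis
  proof cases
    case 1
    have "\<exists>v \<in> insert n E. card {f \<in> E. v \<le> f} = c"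
    proof (cases "c = 0")
      case True
      have "card {f \<in> E. n \<le> f} = 0"
        unfolding card_eq_0_iff using E r by auto
      thus ?thesis using True by blast
    next
      case False
      then obtain v where v: "v \<in> E" "card {f \<in> E. f < v} = card E - c"
        using ex_rank[of E "card E - c"] 1 fin by auto
      have "card {f \<in> E. v \<le> f} = c" using split_E[of v] v(2) 1 by linarith
      thus ?thesis using v(1) by blast
    qed
    then obtain v where v: "v \<in> insert n E" "card {f \<in> E. v \<le> f} = c" by blast
    have "r \<le> v" "v \<le> n" using v(1) E r by auto
    then obtain g s where "shift_insertion r n p v g s"
      using ex_shift_insertion[OF r p] by blast
    then interpret ins: shift_insertion r n p v g s .
    \<comment> \<open>Since \<open>v\<close> lies in \<open>insert n E\<close>, it is itself the
      freed value and becomes a fixed point.\<close>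
    have "\<not> v < s v"
      using ins.s_x_least(3)[of v] v(1) by (simp add: E_def P_def)
    hence "exc r n s = e" "den r n s = den r (n - 1) p + c"
      using ins.exc_shift ins.den_shift_fixed v(2) by (simp_all add: E_def P_def e_def)
    moreover have "c \<le> e + r - 1"
      using 1 card_E card_AB r by simp
    moreover have "inserts r n p s"
      using ins.shift_insertion_axioms unfolding inserts_def by blast
    ultimately show ?thesis unfolding e_def by auto
  next
    case 2
    hence "c - card E - 1 < card B"
      using card_E card_AB by simp
    \<comment> \<open>Counting \<open>i\<close> itself, exactly \<open>c - card E\<close> small
      non-excedance places are at most \<open>i\<close>.\<close>
    then obtain i where i: "i \<in> B" "card {b \<in> B. b < i} = c - card E - 1"
      using ex_rank[OF fin(4)] by blast
    have i': "1 \<le> i" "i < r" "i \<notin> A"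
      using i AB by auto
    have "card ({a \<in> A. a < i} \<union> {b \<in> B. b < i}) = card {a \<in> A. a < i} + card {b \<in> B. b < i}"
      by (rule card_Un_disjoint) (use fin AB in auto)
    moreover have "{a \<in> A. a < i} \<union> {b \<in> B. b < i} = {1..<i}"
    proof -
      have "{a \<in> A. a < i} \<union> {b \<in> B. b < i} = {q \<in> A \<union> B. q < i}" by blast
      also have "\<dots> = {1..<i}" unfolding AB(1) using i'(2) by auto
      finally show ?thesis .
    qed
    ultimately have count: "card {a \<in> A. a < i} + (c - card E - 1) = i - 1"
      using i(2) by simp
    have le: "card {a \<in> A. a < i} \<le> card A"
      using fin by (intro card_mono) auto
    have "card A - card {a \<in> A. a < i} < card (insert i A)" using fin i' by simp
    then obtain x where x: "x \<in> insert i A"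
      "card {q \<in> insert i A. q < x} = card A - card {a \<in> A. a < i}"
      using ex_rank[of "insert i A"] fin by blast
    have "x < r" using x(1) i' by (auto simp: A_def)
    have A_i: "{q \<in> P. q < i} = {a \<in> A. a < i}"
      using i' by (auto simp: A_def)
    have "\<exists>g s. cross_insertion r n p x g s i"
      using x le i i' \<open>x < r\<close> A_i unfolding A_def B_def P_def
      by (intro ex_cross_insertion[OF r p]) simp_all
    then obtain g s where "cross_insertion r n p x g s i" by blast
    then interpret ins: cross_insertion r n p x g s i .
    \<comment> \<open>With \<open>count\<close>, the excedance places below \<open>i\<close> cancel
      and the growth becomes \<open>e + card A + (c - card E) = c\<close>.\<close>
    have "den r n s = den r (n - 1) p + e + i + (card A - card {a \<in> A. a < i})"
      using ins.den_cross x(2) by (simp add: e_def A_def P_def)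
    hence "den r n s = den r (n - 1) p + c"
      using count le i' 2 card_E by simp
    moreover have "exc r n s = e"
      using ins.exc_cross i' by (simp add: e_def)
    moreover have "c \<le> e + r - 1"
      using 2 by simp
    moreover have "inserts r n p s"
      using ins.cross_insertion_axioms unfolding inserts_def by blast
    ultimately show ?thesis unfolding e_def by auto
  next
    case 3
    have "r \<notin> A" by (simp add: A_def)
    hence "card (insert r A) = Suc (card A)" using fin by simp
    moreover have lt: "c - e - r < card A"
      using 3 card_E by simp
    ultimately obtain x where x: "x \<in> insert r A" "card {q \<in> insert r A. q < x} = c - e - r"
      using ex_rank[of "insert r A" "c - e - r"] fin by auto
    \<comment> \<open>The rank of \<open>r\<close> is \<open>card A\<close>, which is too
      large.\<close>
    have "x \<noteq> r"
    proof
      assume "x = r"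
      hence "{q \<in> insert r A. q < x} = A" by (auto simp: A_def)
      thus False using x(2) lt by simp
    qed
    hence "x < r" using x(1) by (auto simp: A_def)
    have "\<exists>g s. cross_insertion r n p x g s r"
      using x(1) \<open>x < r\<close> unfolding A_def P_def
      by (intro ex_cross_insertion[OF r p]) simp_all
    then obtain g s where "cross_insertion r n p x g s r" by blast
    then interpret ins: cross_insertion r n p x g s r .
    have "den r n s = den r (n - 1) p + e + r + (c - e - r)"
      using ins.den_cross x(2) by (simp add: e_def A_def P_def)
    hence "den r n s = den r (n - 1) p + c"
      using 3 by simp
    moreover have "exc r n s = e + 1"
      using ins.exc_cross by (simp add: e_def)
    moreover have "\<not> c \<le> e + r - 1"
      using 3 r by simp
    moreover have "inserts r n p s"
      using ins.cross_insertion_axioms unfolding inserts_def by blast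
    ultimately show ?thesis unfolding e_def by auto
  next
    case 4
    have "card ({r..<n} - E) = n - r - card E"
      using fin E by (simp add: card_Diff_subset)
    hence "c - r - card E < card ({r..<n} - E)"
      using 4 c r by simp
    \<comment> \<open>Passing one more non-value raises
      \<open>v + card {f \<in> E. v \<le> f}\<close> by one: every value of \<open>E\<close> skipped
      over adds one to \<open>v\<close> and leaves the second set. The least non-value gives
      \<open>r + card E\<close>.\<close>
    then obtain v where v: "v \<in> {r..<n} - E" "card {f \<in> {r..<n} - E. f < v} = c - r - card E"
      using ex_rank[of "{r..<n} - E"] by blast
    have "card ({f \<in> {r..<n} - E. f < v} \<union> {f \<in> E. f < v}) =
        card {f \<in> {r..<n} - E. f < v} + card {f \<in> E. f < v}"
      by (rule card_Un_disjoint) (use fin in auto)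
    moreover have "{f \<in> {r..<n} - E. f < v} \<union> {f \<in> E. f < v} = {r..<v}"
      using v(1) E by force
    ultimately have "c - r - card E + card {f \<in> E. f < v} = v - r"
      using v(2) by simp
    moreover have "r \<le> v" "v \<le> n" using v(1) by auto
    ultimately have count: "v + card {f \<in> E. v \<le> f} = c"
      using 4 split_E[of v] by linarith
    obtain g s where "shift_insertion r n p v g s"
      using ex_shift_insertion[OF r p \<open>r \<le> v\<close> \<open>v \<le> n\<close>] by blast
    then interpret ins: shift_insertion r n p v g s .
    have "s v \<noteq> v"
      using ins.s_x_least(1) v(1) by (auto simp: E_def P_def)
    hence "v < s v" using ins.s_x_least(2) by simp
    hence "exc r n s = e + 1" "den r n s = den r (n - 1) p + c"
      using ins.exc_shift ins.den_shift_excedance count by (simp_all add: E_def P_def e_def)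
    moreover have "\<not> c \<le> e + r - 1"
      using 4 card_E r by simp
    moreover have "inserts r n p s"
      using ins.shift_insertion_axioms unfolding inserts_def by blast
    ultimately show ?thesis unfolding e_def by auto
  qed
qed

section \<open>From the relation to the bijection\<close>

theorem theorem1:
  fixes r n :: nat
  assumes "1 \<le> r" and "r < n"
  shows "\<exists>\<phi> :: (nat \<Rightarrow> nat) \<times> nat \<Rightarrow> (nat \<Rightarrow> nat).
    bij_betw \<phi> (Sym (n - 1) \<times> {0..n - 1}) (Sym n) \<and>
    (\<forall>\<pi> \<in> Sym (n - 1). \<forall>c \<in> {0..n - 1}.
       exc r n (\<phi> (\<pi>, c)) =
         (if c \<le> exc r (n - 1) \<pi> + r - 1 then exc r (n - 1) \<pi> else exc r (n - 1) \<pi> + 1) \<and>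
       den r n (\<phi> (\<pi>, c)) = den r (n - 1) \<pi> + c)"
proof -
  let ?X = "Sym (n - 1) \<times> {0..n - 1}"
  let ?good = "\<lambda>\<pi> c s. inserts r n \<pi> s \<and>
    exc r n s = (if c \<le> exc r (n - 1) \<pi> + r - 1 then exc r (n - 1) \<pi> else exc r (n - 1) \<pi> + 1) \<and>
    den r n s = den r (n - 1) \<pi> + c"
  define \<phi> where "\<phi> = (\<lambda>(\<pi>, c). SOME s. ?good \<pi> c s)"
  have good: "?good \<pi> c (\<phi> (\<pi>, c))" if "\<pi> \<in> Sym (n - 1)" "c \<in> {0..n - 1}" for \<pi> c
    using someI_ex[OF ex_inserts[OF assms, of \<pi> c]] that by (simp add: \<phi>_def)
  have inj: "inj_on \<phi> ?X"
  proof (rule inj_onI, clarify)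
    fix p c p' c'
    assume *: "p permutes {1..n - 1}" "c \<in> {0..n - 1}" "p' permutes {1..n - 1}" "c' \<in> {0..n - 1}"
      and eq: "\<phi> (p, c) = \<phi> (p', c')"
    have g: "?good p c (\<phi> (p, c))" "?good p' c' (\<phi> (p', c'))"
      using good[of p c] good[of p' c'] * by blast+
    \<comment> \<open>The relation recovers the permutation; the increment then follows from the
      equation for \<open>den\<close>.\<close>
    have "p = p'"
      by (rule inserts_inj[of r n p "\<phi> (p, c)"]) (use g eq in simp_all)
    moreover have "den r (n - 1) p + c = den r (n - 1) p' + c'"
      using g eq by metis
    ultimately show "p = p' \<and> c = c'" by simp
  qed
  \<comment> \<open>Surjectivity by counting: an injective image of size \<open>(n - 1)! * n\<close>
    fills \<open>Sym n\<close>.\<close>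
  have "\<phi> ` ?X = Sym n"
  proof (rule card_subset_eq)
    show "finite (Sym n)" by (rule finite_permutations) simp
    show "\<phi> ` ?X \<subseteq> Sym n"
      using good inserts_permutes by fast
    have "fact n = n * (fact (n - 1) :: nat)"
      using assms by (simp add: fact_reduce)
    moreover have "Suc (n - 1) = n" using assms by simp
    ultimately show "card (\<phi> ` ?X) = card (Sym n)"
      using inj card_permutations[of "{1..n - 1}" "n - 1"] card_permutations[of "{1..n}" n]
      by (simp add: card_image card_cartesian_product mult.commute)
  qed
  with inj good show ?thesis
    by (intro exI[of _ \<phi>]) (auto simp: bij_betw_def)
qed

end
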